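(* Let $a_i^j,\bar a_i^j$ ($i,j\in\{1,2\}$) be four commuting copies of a boson algebra and let $\sigma_L,\sigma_R$ be the operators defined in the context. Put $$x=a_1^1e^{(-\sigma_L+\sigma_R)/2},\quad u=a_1^2e^{-(\sigma_L+\sigma_R)/2},\quad v=a_2^1e^{(\sigma_L+\sigma_R)/2},\quad y=a_2^2e^{(\sigma_L-\sigma_R)/2}.$$ Then $x,u,v,y$ satisfy the commutation relations of the generators of $GL_h(2)$, namely $$[v,x]=hv^2,\quad[u,x]=h(D-x^2),\quad[v,y]=hv^2,\quad[u,y]=h(D-y^2),\quad[x,y]=h(xv-yv),\quad[v,u]=h(xv+vy),$$ where $D=xy-uv-hxv$. Moreover, in this realization the central element $D$ is given by (and so remains undeformed) $$D=xy-uv-hxv=a_1^1a_2^2-a_2^1a_1^2 .$$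
   Context: Boson operators: $[\bar a_i^j,a_k^\ell]=\delta_{i,k}\delta^{j,\ell}$, $[a_i^j,a_k^\ell]=[\bar a_i^j,\bar a_k^\ell]=0$ for $i,j,k,\ell\in\{1,2\}$. Left and right raising operators: $J_+=a_2^1\bar a_1^1+a_2^2\bar a_1^2$ and $K_+=a_1^1\bar a_1^2+a_2^1\bar a_2^2$ (these commute). With $h$ the deformation parameter, $$\sigma_L=-\ln(1-2hJ_+)=\sum_{n\ge1}\frac{(2hJ_+)^n}{n},\qquad \sigma_R=-\ln(1-2hK_+)=\sum_{n\ge1}\frac{(2hK_+)^n}{n},$$ understood as formal power series in $h$, as are their exponentials. *)

theory Defs
  imports Complex_Main "HOL-Computational_Algebra.Formal_Power_Series"
begin

definition commutator :: "'a::ring \<Rightarrow> 'a \<Rightarrow> 'a" where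
  "commutator p q = p * q - q * p"

text \<open>
  The argument \<open>a i j\<close> stands for $a_i^j$ and \<open>b i j\<close> for $\bar a_i^j$; only indices in
  \<open>{1, 2}\<close> matter. The ambient algebra is an arbitrary associative unital algebra
  containing such elements (\<open>real_algebra_1\<close> below supplies the rational scalars
  needed for the exponential and the logarithm; complex algebras are included).
\<close>

definition boson_quadruple :: "(nat \<Rightarrow> nat \<Rightarrow> 'a::ring_1) \<Rightarrow> (nat \<Rightarrow> nat \<Rightarrow> 'a) \<Rightarrow> bool" where
  "boson_quadruple a b \<longleftrightarrow>
     (\<forall>i\<in>{1, 2}. \<forall>j\<in>{1, 2}. \<forall>k\<in>{1, 2}. \<forall>l\<in>{1, 2}.
        commutator (b i j) (a k l) = (if i = k \<and> j = l then 1 else 0) \<and>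
        commutator (a i j) (a k l) = 0 \<and>
        commutator (b i j) (b k l) = 0)"

definition J_plus :: "(nat \<Rightarrow> nat \<Rightarrow> 'a::ring_1) \<Rightarrow> (nat \<Rightarrow> nat \<Rightarrow> 'a) \<Rightarrow> 'a" where
  "J_plus a b = a 2 1 * b 1 1 + a 2 2 * b 1 2"

definition K_plus :: "(nat \<Rightarrow> nat \<Rightarrow> 'a::ring_1) \<Rightarrow> (nat \<Rightarrow> nat \<Rightarrow> 'a) \<Rightarrow> 'a" where
  "K_plus a b = a 1 1 * b 1 2 + a 2 1 * b 2 2"

text \<open>
  Power series in the deformation parameter $h$ have type \<open>'a fps\<close>, with $h$ the central
  indeterminate \<open>fps_X\<close>. The infinite sums below are limits in the $h$-adic
  topology of \<open>'a fps\<close>. The library's \<open>fps_exp\<close> and \<open>fps_ln\<close> are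
  scalar series in the indeterminate, not functions of a series with
  noncommuting coefficients.
\<close>

definition scalar :: "real \<Rightarrow> 'a::real_algebra_1 fps" where
  "scalar r = fps_const (of_real r)"

definition formal_exp :: "'a::real_algebra_1 fps \<Rightarrow> 'a fps" where
  "formal_exp f = (\<Sum>n. scalar (1 / fact n) * f ^ n)"

text \<open>The series $-\ln(1-f)=\sum_{n\ge1} f^n/n$, with summation index shifted to start at 0.\<close>

definition neg_ln_one_minus :: "'a::real_algebra_1 fps \<Rightarrow> 'a fps" where
  "neg_ln_one_minus f = (\<Sum>n. scalar (1 / real (Suc n)) * f ^ Suc n)"

definition sigma_L :: "(nat \<Rightarrow> nat \<Rightarrow> 'a::real_algebra_1) \<Rightarrow> (nat \<Rightarrow> nat \<Rightarrow> 'a) \<Rightarrow> 'a fps" where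
  "sigma_L a b = neg_ln_one_minus (2 * fps_X * fps_const (J_plus a b))"

definition sigma_R :: "(nat \<Rightarrow> nat \<Rightarrow> 'a::real_algebra_1) \<Rightarrow> (nat \<Rightarrow> nat \<Rightarrow> 'a) \<Rightarrow> 'a fps" where
  "sigma_R a b = neg_ln_one_minus (2 * fps_X * fps_const (K_plus a b))"

text \<open>
  These sums converge when the argument has zero constant term; the logarithm then again has
  zero constant term, so that every exponential and logarithm used in the statement is
  the limit of its series.
\<close>

lemma formal_series_sums:
  fixes f :: "'a::real_algebra_1 fps"
  assumes "fps_nth f 0 = 0"
  shows "(\<lambda>n. scalar (c n) * f ^ n) sums Abs_fps (\<lambda>k. \<Sum>n\<le>k. c n *\<^sub>R fps_nth (f ^ n) k)"
  unfolding sums_def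
proof (rule tendsto_fpsI)
  fix k
  have "fps_nth (\<Sum>n<N. scalar (c n) * f ^ n) k = (\<Sum>n\<le>k. c n *\<^sub>R fps_nth (f ^ n) k)"
    if "N > k" for N
  proof -
    have "fps_nth (\<Sum>n<N. scalar (c n) * f ^ n) k = (\<Sum>n<N. c n *\<^sub>R fps_nth (f ^ n) k)"
      by (simp add: fps_sum_nth scalar_def scaleR_conv_of_real)
    also have "\<dots> = (\<Sum>n\<le>k. c n *\<^sub>R fps_nth (f ^ n) k)"
      by (rule sum.mono_neutral_right) (use that startsby_zero_power_prefix[OF assms] in auto)
    finally show ?thesis .
  qed
  then show "\<forall>\<^sub>F N in sequentially. fps_nth (\<Sum>n<N. scalar (c n) * f ^ n) k =
      fps_nth (Abs_fps (\<lambda>k. \<Sum>n\<le>k. c n *\<^sub>R fps_nth (f ^ n) k)) k"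
    unfolding eventually_at_top_dense by auto
qed

lemma formal_exp_sums:
  fixes f :: "'a::real_algebra_1 fps"
  assumes "fps_nth f 0 = 0"
  shows "(\<lambda>n. scalar (1 / fact n) * f ^ n) sums formal_exp f"
  unfolding formal_exp_def
  by (rule summable_sums, rule sums_summable, rule formal_series_sums[OF assms])

lemma neg_ln_one_minus_sums:
  fixes f :: "'a::real_algebra_1 fps"
  assumes "fps_nth f 0 = 0"
  shows "(\<lambda>n. scalar (1 / real (Suc n)) * f ^ Suc n) sums neg_ln_one_minus f"
    and "fps_nth (neg_ln_one_minus f) 0 = 0"
proof -
  define g where "g = Abs_fps (\<lambda>k. \<Sum>n\<le>k. (1 / real n) *\<^sub>R fps_nth (f ^ n) k)"
  have *: "(\<lambda>n. scalar (1 / real n) * f ^ n) sums g"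
    unfolding g_def by (rule formal_series_sums[OF assms])
  have "(\<lambda>n. scalar (1 / real (Suc n)) * f ^ Suc n) sums g"
  proof -
    have "(\<lambda>N. \<Sum>n<Suc N. scalar (1 / real n) * f ^ n) \<longlonglongrightarrow> g"
      using * unfolding sums_def by (rule LIMSEQ_Suc)
    moreover have "(\<Sum>n<Suc N. scalar (1 / real n) * f ^ n) =
        (\<Sum>n<N. scalar (1 / real (Suc n)) * f ^ Suc n)" for N
      by (subst sum.lessThan_Suc_shift) (simp add: scalar_def)
    ultimately show ?thesis by (simp add: sums_def)
  qed
  then have "neg_ln_one_minus f = g"
    and "(\<lambda>n. scalar (1 / real (Suc n)) * f ^ Suc n) sums neg_ln_one_minus f"
    unfolding neg_ln_one_minus_def by (auto dest: sums_unique simp only: sums_iff)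
  then show "(\<lambda>n. scalar (1 / real (Suc n)) * f ^ Suc n) sums neg_ln_one_minus f"
    and "fps_nth (neg_ln_one_minus f) 0 = 0"
    by (simp_all only: g_def) simp
qed

end

theory Submission
  imports Defs
begin

text \<open>
  The exponentials of logarithms are inverse square roots in disguise. With \<open>J = J_plus a b\<close>
  and \<open>K = K_plus a b\<close>, put \<open>A = exp (\<sigma>L/2)\<close> and \<open>B = exp (\<sigma>R/2)\<close>; these are \<open>1 - 2hJ\<close> and
  \<open>1 - 2hK\<close> to the power \<open>-1/2\<close>. The operators \<open>J\<close> and \<open>K\<close> commute, so \<open>A\<close> and \<open>B\<close> do,
  and \<open>x\<close>, \<open>u\<close>, \<open>v\<close>, \<open>y\<close> are the four \<open>a i j\<close> multiplied on the right by \<open>A\<close> or its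
  inverse and by \<open>B\<close> or its inverse.

  The bracket with \<open>J\<close> sends \<open>a 1 j\<close> to \<open>a 2 j\<close> and kills \<open>a 2 j\<close>; the bracket with \<open>K\<close>
  sends \<open>a i 2\<close> to \<open>a i 1\<close> and kills \<open>a i 1\<close>. Each bracket thus has square zero on the
  linear span of the \<open>a i j\<close>, so a power series \<open>F\<close> in \<open>hJ\<close> satisfies the first-order Taylor
  formula \<open>F(hJ) c = c F(hJ) + h [J, c] F'(hJ)\<close> for \<open>c\<close> in that span
  (\<open>fps_at_mult_const\<close>). The power \<open>-1/2\<close> of \<open>1 - 2X\<close> is a solution \<open>P\<close> of \<open>P' = P ^ 3\<close>
  (\<open>deriv_inv_sqrt\<close>), so
  \<open>A (a 1 j) = (a 1 j) A + h (a 2 j) A ^ 3\<close> and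
  \<open>B (a i 2) = (a i 2) B + h (a i 1) B ^ 3\<close>, while \<open>A\<close> commutes with \<open>a 2 j\<close> and \<open>B\<close> with
  \<open>a i 1\<close>. These exchange relations already imply the theorem (\<open>GL_h_relations\<close>): they
  rewrite every word with \<open>h\<close> on the left, then the \<open>a i j\<close>, then the powers of \<open>A\<close> and
  \<open>B\<close>, and the two sides of each claimed relation have the same normal form.

  To identify \<open>exp (\<sigma>L/2)\<close> with \<open>P(hJ)\<close>, note that \<open>F \<mapsto> F(hJ)\<close> is an algebra homomorphism
  from real power series that is compatible with the exponential and the logarithm; calculus
  is then needed only for real series. What has to be done with noncommuting coefficients is
  the law \<open>exp (f + g) = exp f * exp g\<close> for commuting \<open>f\<close> and \<open>g\<close> (\<open>formal_exp_add\<close>),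
  which splits the four exponentials into factors.
\<close>

section \<open>Coefficients of the exponential and logarithmic series\<close>

lemma formal_exp_nth:
  fixes f :: "'a::real_algebra_1 fps"
  assumes "fps_nth f 0 = 0"
  shows "fps_nth (formal_exp f) k = (\<Sum>n\<le>k. (1 / fact n) *\<^sub>R fps_nth (f ^ n) k)"
  using sums_unique2[OF formal_exp_sums[OF assms] formal_series_sums[OF assms]] by simp

lemma neg_ln_one_minus_nth:
  fixes f :: "'a::real_algebra_1 fps"
  assumes "fps_nth f 0 = 0"
  shows "fps_nth (neg_ln_one_minus f) k = (\<Sum>n\<le>k. (1 / real n) *\<^sub>R fps_nth (f ^ n) k)"
proof -
  have "(\<lambda>n. scalar (1 / real (Suc n)) * f ^ Suc n) sums
      (Abs_fps (\<lambda>k. \<Sum>n\<le>k. (1 / real n) *\<^sub>R fps_nth (f ^ n) k) - scalar (1 / real 0) * f ^ 0)"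
    using LIMSEQ_Suc[OF formal_series_sums[OF assms, of "\<lambda>n. 1 / real n", unfolded sums_def]]
    by (simp add: sums_def sum.lessThan_Suc_shift scalar_def del: sum.lessThan_Suc)
  from sums_unique2[OF neg_ln_one_minus_sums(1)[OF assms] this] show ?thesis
    by (simp add: scalar_def)
qed

section \<open>Evaluation of real power series at a multiple of the indeterminate\<close>

text \<open>
  The series \<open>F(hJ)\<close>. It exists for every \<open>F\<close> because the factor \<open>h\<close> puts the
  \<open>n\<close>-th term in degree \<open>n\<close>. All its terms lie in the commutative algebra generated by
  \<open>h\<close> and \<open>J\<close>, which lets identities of real series be carried over.
\<close>

definition fps_at :: "'a::real_algebra_1 \<Rightarrow> real fps \<Rightarrow> 'a fps" where
  "fps_at J F = Abs_fps (\<lambda>n. fps_nth F n *\<^sub>R J ^ n)"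

lemma fps_at_nth [simp]: "fps_nth (fps_at J F) n = fps_nth F n *\<^sub>R J ^ n"
  by (simp add: fps_at_def)

lemma fps_at_1 [simp]: "fps_at J 1 = 1"
  by (simp add: fps_eq_iff)

lemma fps_at_mult: "fps_at J (F * G) = fps_at J F * fps_at J G"
  by (simp add: fps_eq_iff fps_mult_nth scaleR_sum_left mult.commute flip: power_add)

lemma fps_at_power: "fps_at J (F ^ n) = fps_at J F ^ n"
  by (induction n) (simp_all add: fps_at_mult)

lemma scalar_mult_fps_at: "scalar c * fps_at J F = fps_at J (scalar c * F)"
  by (simp add: scalar_def fps_eq_iff scaleR_conv_of_real mult.assoc)

lemma fps_at_formal_exp:
  assumes "fps_nth F 0 = 0"
  shows "formal_exp (fps_at J F) = fps_at J (formal_exp F)"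
  using assms by (simp add: fps_eq_iff formal_exp_nth scaleR_sum_left flip: fps_at_power)

lemma fps_at_neg_ln_one_minus:
  assumes "fps_nth F 0 = 0"
  shows "neg_ln_one_minus (fps_at J F) = fps_at J (neg_ln_one_minus F)"
  using assms by (simp add: fps_eq_iff neg_ln_one_minus_nth scaleR_sum_left flip: fps_at_power)

lemma fps_at_commute:
  assumes "J * K = K * J"
  shows "fps_at J F * fps_at K G = fps_at K G * fps_at J F"
proof -
  have JK: "J ^ m * K ^ n = K ^ n * J ^ m" for m n
    using assms by (metis power_commuting_commutes)
  show ?thesis
  proof (rule fps_ext)
    fix n
    have "fps_nth (fps_at J F * fps_at K G) n
        = (\<Sum>i=0..n. fps_nth (fps_at K G) (n - i) * fps_nth (fps_at J F) i)"
      by (simp add: fps_mult_nth JK mult.commute)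
    also have "\<dots> = fps_nth (fps_at K G * fps_at J F) n"
      unfolding fps_mult_nth
      by (rule sum.reindex_bij_witness[of _ "\<lambda>i. n - i" "\<lambda>i. n - i"]) auto
    finally show "fps_nth (fps_at J F * fps_at K G) n = fps_nth (fps_at K G * fps_at J F) n" .
  qed
qed

lemma power_mult_commutator:
  fixes J c d :: "'a::real_algebra_1"
  assumes "commutator J c = d" "commutator J d = 0"
  shows "J ^ n * c = c * J ^ n + real n *\<^sub>R (d * J ^ (n - 1))"
proof (induction n)
  case (Suc n)
  have Jc: "J * c = c * J + d" and Jd: "J * d = d * J"
    using assms by (auto simp: commutator_def)
  have "J ^ Suc n * c = J * (c * J ^ n + real n *\<^sub>R (d * J ^ (n - 1)))"
    using Suc by (simp add: mult.assoc)
  also have "\<dots> = (J * c) * J ^ n + real n *\<^sub>R ((J * d) * J ^ (n - 1))"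
    by (simp add: distrib_left mult.assoc)
  also have "\<dots> = c * J ^ Suc n + d * J ^ n + real n *\<^sub>R (d * (J * J ^ (n - 1)))"
    unfolding Jc Jd by (simp add: distrib_right mult.assoc)
  also have "\<dots> = c * J ^ Suc n + real (Suc n) *\<^sub>R (d * J ^ n)"
    by (cases n) (simp_all add: scaleR_add_left scaleR_2)
  finally show ?case by simp
qed simp

text \<open>
  Taylor's formula for moving \<open>c\<close> past \<open>F(hJ)\<close>. It stops after the first derivative
  because the second bracket with \<open>J\<close> vanishes. The explicit factor \<open>h\<close> appears because the
  bracket removes \<open>J\<close> from one factor \<open>hJ\<close> and leaves its \<open>h\<close> behind.
\<close>

lemma fps_at_mult_const:
  fixes J c d :: "'a::real_algebra_1"
  assumes "commutator J c = d" "commutator J d = 0"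
  shows "fps_at J F * fps_const c =
    fps_const c * fps_at J F + fps_X * fps_const d * fps_at J (fps_deriv F)"
proof (rule fps_ext)
  fix n
  show "fps_nth (fps_at J F * fps_const c) n =
     fps_nth (fps_const c * fps_at J F + fps_X * fps_const d * fps_at J (fps_deriv F)) n"
    by (cases n)
      (simp_all add: power_mult_commutator[OF assms] mult.assoc scaleR_add_right
        mult.commute[of "real _"] del: power_Suc of_nat_Suc)
qed

section \<open>The exponential of a sum of commuting series\<close>

lemma binomial_commuting:
  fixes f g :: "'a::ring_1"
  assumes "f * g = g * f"
  shows "(f + g) ^ n = (\<Sum>i\<le>n. of_nat (n choose i) * (f ^ i * g ^ (n - i)))"
proof (induction n)
  case (Suc n)
  have gf: "g * f ^ i = f ^ i * g" for i
    using assms by (metis power_commuting_commutes)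
  have of_nat_left: "e * (of_nat m * e') = of_nat m * (e * e')" for e e' :: 'a and m
    by (simp only: mult.assoc[symmetric] mult_of_nat_commute[of m e])
  have 1: "f * (of_nat (n choose i) * (f ^ i * g ^ (n - i)))
      = of_nat (n choose i) * (f ^ Suc i * g ^ (n - i))" for i
    by (simp add: of_nat_left mult.assoc)
  have 2: "g * (of_nat (n choose i) * (f ^ i * g ^ (n - i)))
      = of_nat (n choose i) * (f ^ i * g ^ (Suc n - i))" if "i \<le> n" for i
  proof -
    have "g * (f ^ i * g ^ (n - i)) = f ^ i * (g * g ^ (n - i))"
      by (simp add: gf flip: mult.assoc)
    then show ?thesis
      using that by (simp add: of_nat_left Suc_diff_le)
  qed
  have "(f + g) ^ Suc n = f * (f + g) ^ n + g * (f + g) ^ n"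
    by (simp add: distrib_right)
  also have "f * (f + g) ^ n = (\<Sum>i\<le>n. of_nat (n choose i) * (f ^ Suc i * g ^ (n - i)))"
    unfolding Suc sum_distrib_left 1 ..
  also have "g * (f + g) ^ n = (\<Sum>i\<le>Suc n. of_nat (n choose i) * (f ^ i * g ^ (Suc n - i)))"
    unfolding Suc sum_distrib_left by (simp add: 2 binomial_eq_0)
  also have "\<dots> = g ^ Suc n + (\<Sum>i\<le>n. of_nat (n choose Suc i) * (f ^ Suc i * g ^ (n - i)))"
    by (subst sum.atMost_Suc_shift) simp
  also have "(\<Sum>i\<le>n. of_nat (n choose i) * (f ^ Suc i * g ^ (n - i))) + \<dots>
      = g ^ Suc n + (\<Sum>i\<le>n. of_nat (Suc n choose Suc i) * (f ^ Suc i * g ^ (n - i)))"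
    by (simp add: sum.distrib distrib_right del: power_Suc)
  also have "\<dots> = (\<Sum>i\<le>Suc n. of_nat (Suc n choose i) * (f ^ i * g ^ (Suc n - i)))"
    by (subst sum.atMost_Suc_shift) simp
  finally show ?case .
qed simp

text \<open>
  In degree \<open>k\<close> the binomial theorem turns the left side into the sum of
  \<open>f ^ i * g ^ j / (i! j!)\<close> over the triangle \<open>i + j \<le> k\<close>, while the right side is the sum over
  the square \<open>i, j \<le> k\<close>. The two agree because \<open>f ^ i * g ^ j\<close> has no terms below degree
  \<open>i + j\<close>.
\<close>

lemma formal_exp_add:
  fixes f g :: "'a::real_algebra_1 fps"
  assumes "f * g = g * f" and f: "fps_nth f 0 = 0" and g: "fps_nth g 0 = 0"
  shows "formal_exp (f + g) = formal_exp f * formal_exp g"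
proof (rule fps_ext)
  fix k
  define w where "w i j = (1 / (fact i * fact j)) *\<^sub>R fps_nth (f ^ i * g ^ j) k" for i j
  have w0: "w i j = 0" if "k < i + j" for i j
  proof -
    have "fps_nth (f ^ i) m * fps_nth (g ^ j) (k - m) = 0" if "m \<le> k" for m
    proof (cases "m < i")
      case False
      then have "k - m < j" using that \<open>k < i + j\<close> by linarith
      then show ?thesis using startsby_zero_power_prefix[OF g, of j] by simp
    qed (use startsby_zero_power_prefix[OF f, of i] in simp)
    then show ?thesis by (simp add: w_def fps_mult_nth)
  qed
  \<comment> \<open>A cutoff independent of the degree \<open>m\<close> permits the interchange of sums below.\<close>
  have ext: "fps_nth (formal_exp e) m = (\<Sum>n\<le>k. (1 / fact n) *\<^sub>R fps_nth (e ^ n) m)"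
    if "fps_nth e 0 = 0" "m \<le> k" for e :: "'a fps" and m
    unfolding formal_exp_nth[OF that(1)]
    by (rule sum.mono_neutral_left) (use that startsby_zero_power_prefix[OF that(1)] in auto)
  have "fps_nth (f + g) 0 = 0"
    by (simp add: f g)
  note fg = formal_exp_nth[OF this]
  have "fps_nth (formal_exp (f + g)) k = (\<Sum>n\<le>k. \<Sum>i\<le>n. w i (n - i))"
    unfolding fg
  proof (rule sum.cong[OF refl])
    fix n
    have "(1 / fact n) *\<^sub>R fps_nth (of_nat (n choose i) * e) k =
        (1 / (fact i * fact (n - i))) *\<^sub>R fps_nth e k" if "i \<le> n" for i and e :: "'a fps"
    proof -
      have "fps_nth (of_nat (n choose i) * e) k = real (n choose i) *\<^sub>R fps_nth e k"
        by (simp add: scaleR_conv_of_real flip: fps_of_nat)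
      then show ?thesis
        using that by (simp add: binomial_fact)
    qed
    then show "(1 / fact n) *\<^sub>R fps_nth ((f + g) ^ n) k = (\<Sum>i\<le>n. w i (n - i))"
      by (simp add: binomial_commuting[OF assms(1)] fps_sum_nth scaleR_sum_right w_def)
  qed
  also have "\<dots> = (\<Sum>(i, j)\<in>{(i, j). i + j \<le> k}. w i j)"
    by (rule sum.triangle_reindex_eq[symmetric])
  also have "\<dots> = (\<Sum>(i, j)\<in>{..k} \<times> {..k}. w i j)"
    by (rule sum.mono_neutral_left) (use w0 not_le in fastforce)+
  also have "\<dots> = (\<Sum>i\<le>k. \<Sum>j\<le>k. w i j)"
    by (simp add: sum.cartesian_product)
  also have "\<dots> = (\<Sum>i\<le>k. \<Sum>j\<le>k. \<Sum>m=0..k.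
      ((1 / fact i) *\<^sub>R fps_nth (f ^ i) m) * ((1 / fact j) *\<^sub>R fps_nth (g ^ j) (k - m)))"
    by (simp add: w_def fps_mult_nth scaleR_sum_right mult.commute)
  also have "\<dots> = (\<Sum>m=0..k. \<Sum>i\<le>k. \<Sum>j\<le>k.
      ((1 / fact i) *\<^sub>R fps_nth (f ^ i) m) * ((1 / fact j) *\<^sub>R fps_nth (g ^ j) (k - m)))"
    by (simp only: sum.swap[of _ "{0..k}" "{..k}"])
  also have "\<dots> = fps_nth (formal_exp f * formal_exp g) k"
    unfolding fps_mult_nth by (rule sum.cong[OF refl]) (simp add: ext f g sum_product)
  finally show "fps_nth (formal_exp (f + g)) k = fps_nth (formal_exp f * formal_exp g) k" .
qed

lemma formal_exp_inverse:
  fixes f :: "'a::real_algebra_1 fps"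
  assumes "fps_nth f 0 = 0"
  shows "formal_exp f * formal_exp (- f) = 1" "formal_exp (- f) * formal_exp f = 1"
proof -
  have z: "formal_exp (0 :: 'a fps) = 1"
    by (simp add: fps_eq_iff formal_exp_nth power_0_left if_distrib if_distribR sum.If_cases
        cong: if_cong)
  show "formal_exp f * formal_exp (- f) = 1" "formal_exp (- f) * formal_exp f = 1"
    using formal_exp_add[of f "- f"] formal_exp_add[of "- f" f] assms z by simp_all
qed

section \<open>The inverse square root as a real power series\<close>

lemma formal_exp_real:
  assumes "fps_nth F 0 = 0"
  shows "formal_exp F = fps_exp (1::real) oo F"
  using assms by (simp add: fps_eq_iff formal_exp_nth fps_compose_nth atLeast0AtMost)

lemma deriv_formal_exp:
  fixes F :: "real fps"
  assumes "fps_nth F 0 = 0"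
  shows "fps_deriv (formal_exp F) = fps_deriv F * formal_exp F"
  using assms by (simp add: formal_exp_real fps_compose_deriv mult.commute)

lemma deriv_neg_ln_one_minus:
  fixes F :: "real fps"
  assumes "fps_nth F 0 = 0"
  shows "(1 - F) * fps_deriv (neg_ln_one_minus F) = fps_deriv F"
proof -
  have "neg_ln_one_minus F = Abs_fps (\<lambda>n. 1 / real n) oo F"
    using assms by (simp add: fps_eq_iff neg_ln_one_minus_nth fps_compose_nth atLeast0AtMost)
  moreover have "(1 - fps_X) * fps_deriv (Abs_fps (\<lambda>n. 1 / real n)) = 1"
    unfolding fps_eq_iff
  proof
    fix n
    show "fps_nth ((1 - fps_X) * fps_deriv (Abs_fps (\<lambda>n. 1 / real n))) n = fps_nth 1 n"
      by (cases n) (simp_all add: left_diff_distrib)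
  qed
  then have "((1 - fps_X) * fps_deriv (Abs_fps (\<lambda>n. 1 / real n))) oo F = 1" by simp
  then have "(1 - F) * (fps_deriv (Abs_fps (\<lambda>n. 1 / real n)) oo F) = 1"
    using assms by (simp add: fps_compose_mult_distrib fps_compose_sub_distrib)
  ultimately show ?thesis using assms
    by (metis fps_compose_deriv mult.assoc mult_1_left)
qed

text \<open>
  The product has derivative zero by the two differential equations above, and its constant
  term is 1.
\<close>

lemma exp_neg_ln_one_minus:
  fixes F :: "real fps"
  assumes "fps_nth F 0 = 0"
  shows "(1 - F) * formal_exp (neg_ln_one_minus F) = 1"
proof -
  let ?L = "neg_ln_one_minus F"
  have L0: "fps_nth ?L 0 = 0" by (rule neg_ln_one_minus_sums(2)[OF assms])
  have "fps_deriv ((1 - F) * formal_exp ?L)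
      = ((1 - F) * fps_deriv ?L - fps_deriv F) * formal_exp ?L"
    by (simp add: deriv_formal_exp[OF L0] algebra_simps)
  also have "\<dots> = 0" by (simp add: deriv_neg_ln_one_minus[OF assms])
  finally have "(1 - F) * formal_exp ?L = fps_const (fps_nth ((1 - F) * formal_exp ?L) 0)"
    by (simp only: fps_deriv_eq_0_iff)
  then show ?thesis by (simp add: assms L0 formal_exp_nth)
qed

text \<open>
  This is \<open>1 - 2X\<close> to the power \<open>-1/2\<close>, in the form in which it enters the exponentials.
\<close>

definition inv_sqrt :: "real fps" where
  "inv_sqrt = formal_exp (scalar (1 / 2) * neg_ln_one_minus (2 * fps_X))"

text \<open>
  With \<open>L = - ln (1 - 2X)\<close>, the series \<open>exp L = 1 / (1 - 2X)\<close> is both half the derivative of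
  \<open>L\<close> and the square of \<open>exp (L/2)\<close>.
\<close>

lemma deriv_inv_sqrt: "fps_deriv inv_sqrt = inv_sqrt ^ 3"
proof -
  define L :: "real fps" where "L = neg_ln_one_minus (2 * fps_X)"
  have L0: "fps_nth L 0 = 0" unfolding L_def by (rule neg_ln_one_minus_sums(2)) simp
  have "scalar (1 / 2) + scalar (1 / 2) = (1 :: real fps)"
    by (simp add: scalar_def)
  then have half: "scalar (1 / 2) * L + scalar (1 / 2) * L = L"
    by (metis distrib_right mult_1_left)
  have sq: "inv_sqrt * inv_sqrt = formal_exp L"
    using formal_exp_add[of "scalar (1 / 2) * L" "scalar (1 / 2) * L", unfolded half]
    by (simp add: inv_sqrt_def scalar_def L0 flip: L_def)
  have unit: "(1 - 2 * fps_X) * formal_exp L = 1"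
    unfolding L_def by (rule exp_neg_ln_one_minus) simp
  have "fps_deriv L = formal_exp L * ((1 - 2 * fps_X) * fps_deriv L)"
    using unit by (simp add: mult.commute mult.left_commute)
  also have "\<dots> = 2 * formal_exp L"
    unfolding L_def by (subst deriv_neg_ln_one_minus) (simp_all add: mult.commute)
  finally have L': "scalar (1 / 2) * fps_deriv L = formal_exp L"
    by (simp add: scalar_def numeral_fps_const flip: mult.assoc)
  have "fps_deriv inv_sqrt = fps_deriv (scalar (1 / 2) * L) * inv_sqrt"
    unfolding inv_sqrt_def by (subst deriv_formal_exp) (simp_all add: L0 scalar_def flip: L_def)
  also have "fps_deriv (scalar (1 / 2) * L) = formal_exp L"
    using L' by (simp add: scalar_def)
  finally show ?thesis
    by (simp add: power3_eq_cube flip: sq)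
qed

lemma neg_ln_one_minus_at:
  "neg_ln_one_minus (2 * fps_X * fps_const J) = fps_at J (neg_ln_one_minus (2 * fps_X))"
proof -
  have "2 * fps_X * fps_const J = fps_at J (2 * fps_X)"
  proof (rule fps_ext)
    fix n
    show "fps_nth (2 * fps_X * fps_const J) n = fps_nth (fps_at J (2 * fps_X)) n"
      by (cases "n = 1") (simp_all add: numeral_fps_const fps_X_def mult.assoc scaleR_conv_of_real)
  qed
  then show ?thesis by (simp add: fps_at_neg_ln_one_minus)
qed

lemma formal_exp_half_neg_ln:
  "formal_exp (scalar (1 / 2) * neg_ln_one_minus (2 * fps_X * fps_const J)) = fps_at J inv_sqrt"
  unfolding neg_ln_one_minus_at scalar_mult_fps_at inv_sqrt_def
  by (rule fps_at_formal_exp) (simp add: scalar_def neg_ln_one_minus_sums(2))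

section \<open>Brackets of the raising operators with the boson operators\<close>

lemma boson_commutators:
  assumes "boson_quadruple a b" "i \<in> {1, 2}" "j \<in> {1, 2}" "k \<in> {1, 2}" "l \<in> {1, 2}"
  shows "b i j * a k l = a k l * b i j + (if i = k \<and> j = l then 1 else 0)"
    and "a i j * a k l = a k l * a i j" and "b i j * b k l = b k l * b i j"
  using assms(1)[unfolded boson_quadruple_def, THEN bspec, THEN bspec, THEN bspec, THEN bspec,
      OF assms(2-5)]
  by (auto simp: commutator_def diff_eq_eq add.commute)

lemma commutator_raising:
  assumes "boson_quadruple a b"
  shows "commutator (J_plus a b) (a 1 1) = a 2 1" "commutator (J_plus a b) (a 1 2) = a 2 2"
    "commutator (J_plus a b) (a 2 1) = 0" "commutator (J_plus a b) (a 2 2) = 0"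
    "commutator (K_plus a b) (a 1 2) = a 1 1" "commutator (K_plus a b) (a 2 2) = a 2 1"
    "commutator (K_plus a b) (a 1 1) = 0" "commutator (K_plus a b) (a 2 1) = 0"
    "commutator (J_plus a b) (K_plus a b) = 0"
proof -
  note ba = boson_commutators(1)[OF assms] and aa = boson_commutators(2)[OF assms]
    and bb = boson_commutators(3)[OF assms]
  \<comment> \<open>Normal ordering: with products nested to the right, every exchange rule is also needed
    in front of a further factor. The rules below move each \<open>a\<close> to the left of each \<open>b\<close>
    and sort the factors of either kind by their indices.\<close>
  have lift: "f * (g * z) = w * z" if "f * g = w" for f g w z :: 'a
    by (simp add: that flip: mult.assoc)
  note BA = ba[of 1 1 1 1] ba[of 1 1 1 2] ba[of 1 1 2 1] ba[of 1 1 2 2]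
    ba[of 1 2 1 1] ba[of 1 2 1 2] ba[of 1 2 2 1] ba[of 1 2 2 2]
    ba[of 2 2 1 1] ba[of 2 2 1 2] ba[of 2 2 2 1] ba[of 2 2 2 2]
  note AA = aa[of 2 1 1 1] aa[of 2 1 1 2] aa[of 2 2 1 1] aa[of 2 2 1 2] aa[of 2 2 2 1] aa[of 1 2 1 1]
  note BB = bb[of 2 2 1 1] bb[of 2 2 1 2] bb[of 1 2 1 1]
  note R = BA[simplified] BA[simplified, THEN lift] AA[simplified] AA[simplified, THEN lift]
    BB[simplified] BB[simplified, THEN lift] commutator_def J_plus_def K_plus_def
    distrib_left distrib_right mult.assoc
  show "commutator (J_plus a b) (a 1 1) = a 2 1" "commutator (J_plus a b) (a 1 2) = a 2 2"
    "commutator (J_plus a b) (a 2 1) = 0" "commutator (J_plus a b) (a 2 2) = 0"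
    "commutator (K_plus a b) (a 1 2) = a 1 1" "commutator (K_plus a b) (a 2 2) = a 2 1"
    "commutator (K_plus a b) (a 1 1) = 0" "commutator (K_plus a b) (a 2 1) = 0"
    "commutator (J_plus a b) (K_plus a b) = 0"
    by (simp_all add: R)
qed

section \<open>The exchange relations imply the relations of the quantum group\<close>

lemma inverse_commutation:
  fixes f f' z w :: "'a::ring_1"
  assumes "f * z = z * f + w" "f * f' = 1" "f' * f = 1"
  shows "f' * z = z * f' - f' * w * f'"
proof -
  have "f' * (f * z) * f' = f' * (z * f) * f' + f' * w * f'"
    unfolding assms(1) by (simp add: algebra_simps)
  moreover have "f' * (f * z) * f' = z * f'"
    by (simp add: mult.assoc[symmetric] assms(3))
  moreover have "f' * (z * f) * f' = f' * z"
    by (simp add: mult.assoc assms(2))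
  ultimately show ?thesis by simp
qed

lemma inverse_commute:
  fixes f f' z :: "'a::ring_1"
  assumes "f * z = z * f" "f * f' = 1" "f' * f = 1"
  shows "f' * z = z * f'"
  using inverse_commutation[of f z 0 f'] assms by simp

text \<open>
  Here \<open>p\<close>, \<open>q\<close>, \<open>r\<close>, \<open>s\<close> stand for \<open>a 1 1\<close>, \<open>a 1 2\<close>, \<open>a 2 1\<close>, \<open>a 2 2\<close>. The exchange
  relations are oriented as rewrite rules that move \<open>h\<close> to the left and \<open>A\<close>, \<open>B\<close> and their
  inverses to the right. This terminates: the extra term created by \<open>A\<close> replaces \<open>p\<close> or \<open>q\<close> by
  \<open>r\<close> or \<open>s\<close>, which commute with \<open>A\<close>, and the extra term created by \<open>B\<close> replaces \<open>q\<close> or \<open>s\<close>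
  by \<open>p\<close> or \<open>r\<close>, which commute with \<open>B\<close>. So every word has a normal form, and each identity
  is checked by comparing normal forms.
\<close>

lemma GL_h_relations:
  fixes p q r s A A' B B' h :: "'a::ring_1"
  assumes h: "\<And>z. z * h = h * z"
    and c: "q * p = p * q" "r * p = p * r" "s * p = p * s"
      "r * q = q * r" "s * q = q * s" "s * r = r * s"
    and A: "A * p = p * A + h * r * A^3" "A * q = q * A + h * s * A^3"
      "A * r = r * A" "A * s = s * A"
    and B: "B * p = p * B" "B * q = q * B + h * p * B^3"
      "B * r = r * B" "B * s = s * B + h * r * B^3"
    and AB: "B * A = A * B"
    and Ai: "A * A' = 1" "A' * A = 1" and Bi: "B * B' = 1" "B' * B = 1"
    and x: "x = p * (A' * B)" and u: "u = q * (A' * B')"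
    and v: "v = r * (A * B)" and y: "y = s * (A * B')"
    and D: "D = x * y - u * v - h * x * v"
  shows "commutator v x = h * v\<^sup>2 \<and> commutator u x = h * (D - x\<^sup>2)
    \<and> commutator v y = h * v\<^sup>2 \<and> commutator u y = h * (D - y\<^sup>2)
    \<and> commutator x y = h * (x * v - y * v) \<and> commutator v u = h * (x * v + v * y)
    \<and> (\<forall>g\<in>{x, u, v, y}. commutator D g = 0) \<and> D = p * s - r * q"
proof -
  \<comment> \<open>Centrality of \<open>h\<close> is instantiated because the general rule would rewrite \<open>h * h\<close> forever.\<close>
  note h' = h[of p] h[of q] h[of r] h[of s] h[of A] h[of A'] h[of B] h[of B']
  have lift: "f * (g * z) = w * z" if "f * g = w" for f g w z :: 'a
    by (simp add: that flip: mult.assoc)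
  have A'rs: "A' * r = r * A'" "A' * s = s * A'"
    using inverse_commute A(3,4) Ai by blast+
  have B'pr: "B' * p = p * B'" "B' * r = r * B'"
    using inverse_commute B(1,3) Bi by blast+
  have A'B: "B * A' = A' * B" using inverse_commute[OF AB[symmetric] Ai] by simp
  have AB': "B' * A = A * B'" by (rule inverse_commute[OF AB Bi])
  have A'B': "B' * A' = A' * B'" by (rule inverse_commute[OF A'B Bi])
  note [simp] = h' h'[THEN lift] A'rs A'rs[THEN lift] B'pr B'pr[THEN lift]
    AB AB[THEN lift] A'B A'B[THEN lift] AB' AB'[THEN lift] A'B' A'B'[THEN lift]
    Ai Ai[THEN lift] Bi Bi[THEN lift]
  have A'pq: "A' * p = p * A' - h * (r * A)" "A' * q = q * A' - h * (s * A)"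
    using inverse_commutation[OF A(1) Ai] inverse_commutation[OF A(2) Ai]
    by (simp_all add: power3_eq_cube mult.assoc)
  have B'qs: "B' * q = q * B' - h * (p * B)" "B' * s = s * B' - h * (r * B)"
    using inverse_commutation[OF B(2) Bi] inverse_commutation[OF B(4) Bi]
    by (simp_all add: power3_eq_cube mult.assoc)
  note [simp] = c c[THEN lift] A A[THEN lift] B B[THEN lift]
    A'pq A'pq[THEN lift] B'qs B'qs[THEN lift]
  note norm = x u v y power3_eq_cube power2_eq_square mult.assoc distrib_left distrib_right
    left_diff_distrib right_diff_distrib
  have D': "D = p * s - r * q"
    unfolding D by (simp add: norm)
  have "commutator v x = h * v\<^sup>2" "commutator v y = h * v\<^sup>2"
    "commutator x y = h * (x * v - y * v)" "commutator v u = h * (x * v + v * y)"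
    by (simp_all add: commutator_def norm)
  moreover have "commutator u x = h * (D - x\<^sup>2)" "commutator u y = h * (D - y\<^sup>2)"
    "commutator D x = 0" "commutator D u = 0" "commutator D v = 0" "commutator D y = 0"
    unfolding D' by (simp_all add: commutator_def norm)
  ultimately show ?thesis
    using D' by simp
qed

section \<open>The boson realization\<close>

theorem proposition5p1:
  fixes a b :: "nat \<Rightarrow> nat \<Rightarrow> 'a::real_algebra_1"
    and \<sigma>L \<sigma>R h x u v y D :: "'a fps"
  assumes "boson_quadruple a b"
    and "\<sigma>L = sigma_L a b"
    and "\<sigma>R = sigma_R a b"
    and "h = fps_X"
    and "x = fps_const (a 1 1) * formal_exp (scalar (1/2) * (- \<sigma>L + \<sigma>R))"
    and "u = fps_const (a 1 2) * formal_exp (- (scalar (1/2) * (\<sigma>L + \<sigma>R)))"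
    and "v = fps_const (a 2 1) * formal_exp (scalar (1/2) * (\<sigma>L + \<sigma>R))"
    and "y = fps_const (a 2 2) * formal_exp (scalar (1/2) * (\<sigma>L - \<sigma>R))"
    and "D = x * y - u * v - h * x * v"
  shows "commutator v x = h * v\<^sup>2
       \<and> commutator u x = h * (D - x\<^sup>2)
       \<and> commutator v y = h * v\<^sup>2
       \<and> commutator u y = h * (D - y\<^sup>2)
       \<and> commutator x y = h * (x * v - y * v)
       \<and> commutator v u = h * (x * v + v * y)
       \<and> (\<forall>g\<in>{x, u, v, y}. commutator D g = 0)
       \<and> D = fps_const (a 1 1 * a 2 2 - a 2 1 * a 1 2)"
proof -
  define J K where "J = J_plus a b" and "K = K_plus a b"
  define sL sR where "sL = scalar (1/2) * \<sigma>L" and "sR = scalar (1/2) * \<sigma>R"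
  note comms = commutator_raising[OF assms(1), folded J_def K_def]
  have sL0: "fps_nth sL 0 = 0" and sR0: "fps_nth sR 0 = 0"
    by (simp_all add: sL_def sR_def assms(2,3) sigma_L_def sigma_R_def scalar_def
        neg_ln_one_minus_sums(2))
  have JK: "J * K = K * J" using comms(9) by (simp add: commutator_def)
  have sLR: "sL * sR = sR * sL"
    unfolding sL_def sR_def assms(2,3) sigma_L_def sigma_R_def neg_ln_one_minus_at scalar_mult_fps_at
    by (rule fps_at_commute) (use JK in \<open>simp add: J_def K_def\<close>)
  define A A' B B' where "A = formal_exp sL" and "A' = formal_exp (- sL)"
    and "B = formal_exp sR" and "B' = formal_exp (- sR)"
  note defs = A_def A'_def B_def B'_def
  \<comment> \<open>\<open>A\<close> and \<open>B\<close> are \<open>1 - 2hJ\<close> and \<open>1 - 2hK\<close> to the power \<open>-1/2\<close>.\<close>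
  have A: "A = fps_at J inv_sqrt" and B: "B = fps_at K inv_sqrt"
    by (simp_all add: A_def B_def sL_def sR_def assms(2,3) sigma_L_def sigma_R_def J_def K_def
        formal_exp_half_neg_ln)
  have A_mult: "A * fps_const c = fps_const c * A + h * fps_const d * A ^ 3"
    if "commutator J c = d" "commutator J d = 0" for c d
    unfolding A \<open>h = fps_X\<close> using fps_at_mult_const[OF that]
    by (simp add: deriv_inv_sqrt fps_at_power)
  have B_mult: "B * fps_const c = fps_const c * B + h * fps_const d * B ^ 3"
    if "commutator K c = d" "commutator K d = 0" for c d
    unfolding B \<open>h = fps_X\<close> using fps_at_mult_const[OF that]
    by (simp add: deriv_inv_sqrt fps_at_power)
  have A_mult0: "A * fps_const c = fps_const c * A" if "commutator J c = 0" for c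
    using A_mult[OF that] by (simp add: commutator_def)
  have B_mult0: "B * fps_const c = fps_const c * B" if "commutator K c = 0" for c
    using B_mult[OF that] by (simp add: commutator_def)
  have aa: "fps_const (a i j) * fps_const (a k l) = fps_const (a k l) * fps_const (a i j)"
    if "i \<in> {1,2}" "j \<in> {1,2}" "k \<in> {1,2}" "l \<in> {1,2}" for i j k l
    using boson_commutators(2)[OF assms(1) that] by simp
  have x: "x = fps_const (a 1 1) * (A' * B)" and u: "u = fps_const (a 1 2) * (A' * B')"
    and v: "v = fps_const (a 2 1) * (A * B)" and y: "y = fps_const (a 2 2) * (A * B')"
  proof -
    have exponents: "scalar (1/2) * (- \<sigma>L + \<sigma>R) = - sL + sR"
      "- (scalar (1/2) * (\<sigma>L + \<sigma>R)) = - sL + - sR"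
      "scalar (1/2) * (\<sigma>L + \<sigma>R) = sL + sR" "scalar (1/2) * (\<sigma>L - \<sigma>R) = sL + - sR"
      by (simp_all add: sL_def sR_def distrib_left right_diff_distrib)
    have "formal_exp (- sL + sR) = A' * B" "formal_exp (- sL + - sR) = A' * B'"
      "formal_exp (sL + sR) = A * B" "formal_exp (sL + - sR) = A * B'"
      unfolding defs by (rule formal_exp_add; simp add: sLR sL0 sR0)+
    then show "x = fps_const (a 1 1) * (A' * B)" "u = fps_const (a 1 2) * (A' * B')"
      "v = fps_const (a 2 1) * (A * B)" "y = fps_const (a 2 2) * (A * B')"
      unfolding assms(5-8) exponents by simp_all
  qed
  have h_central: "z * h = h * z" for z
    by (simp add: \<open>h = fps_X\<close> fps_mult_fps_X_commute)
  have BA: "B * A = A * B"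
    unfolding A B by (rule fps_at_commute) (simp add: JK)
  have "commutator v x = h * v\<^sup>2
       \<and> commutator u x = h * (D - x\<^sup>2)
       \<and> commutator v y = h * v\<^sup>2
       \<and> commutator u y = h * (D - y\<^sup>2)
       \<and> commutator x y = h * (x * v - y * v)
       \<and> commutator v u = h * (x * v + v * y)
       \<and> (\<forall>g\<in>{x, u, v, y}. commutator D g = 0)
       \<and> D = fps_const (a 1 1) * fps_const (a 2 2) - fps_const (a 2 1) * fps_const (a 1 2)"
    by (rule GL_h_relations[OF h_central _ _ _ _ _ _ A_mult A_mult A_mult0 A_mult0
          B_mult0 B_mult B_mult0 B_mult BA
          formal_exp_inverse[OF sL0, folded defs] formal_exp_inverse[OF sR0, folded defs]
          x u v y assms(9)])
      (simp_all add: comms aa del: fps_const_mult One_nat_def)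
  then show ?thesis
    unfolding fps_const_mult fps_const_sub .
qed

end
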